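(* There exists a (randomized) instance of the MNL-Bandit problem with $v_0\ge v_i$, $i=1,\dots,N$, such that for any $N$ and $K$, and any policy $\pi$ that offers an assortment $S_t^\pi$ with $|S_t^\pi|\le K$ at time $t$, we have for all $T\ge N$ that $$Reg_\pi(T,\mathbf{v}) := \mathbb{E}_\pi\left(\sum_{t=1}^T R(S^*,\mathbf{v})-R(S_t^\pi,\mathbf{v})\right)\ \ge\ C\sqrt{\frac{NT}{K}},$$ where $S^*$ is the (at most) $K$-cardinality assortment with maximum expected revenue, and $C$ is an absolute constant.
   Context: **MNL-Bandit problem (cardinality constrained).** There are $N$ products with known revenues $r_i$ and attraction parameters $v_i$ unknown to the seller; $v_0$ is the parameter of the no-purchase option $0$. Write $\mathbf v=(v_0,\dots,v_N)$. $K$ is the bound on the number of products that can be offered in an assortment, and $T$ is the time horizon. At each time $t=1,\dots,T$ the seller offers an assortment $S_t\subseteq\{1,\dots,N\}$ with $|S_t|\le K$ and observes $c_t\in S_t\cup\{0\}$; conditionally on $S_t=S$, $c_t$ is independent of $c_1,\dots,c_{t-1}$ and equals $i$ with probability $v_i/(v_0+\sum_{j\in S}v_j)$ for $i\in S\cup\{0\}$. The expected revenue is $R(S,\mathbf{v})=\sum_{i\in S}r_iv_i/(v_0+\sum_{j\in S}v_j)$. A policy $\pi$ chooses $S_t$ as a measurable function of an exogenous randomization variable $U$ and of the history $c_1,\dots,c_{t-1},S_1,\dots,S_{t-1}$; it does not know $\mathbf{v}$. A randomized instance is one whose parameter vector $\mathbf v$ is drawn at random; the expectation in the regret is then also over this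 draw.
   Formalization: Requires N ≥ 2 (for N = 1 always offering the better of {1} and the empty set has zero regret, so the bound fails) and K ≥ 1; the randomized instance may depend on N, K and T, since no single prior gives the bound for all T. *)

theory Defs
  imports "HOL-Probability.Probability"
begin

text \<open>
  Products are the numbers \<open>1..N\<close> and \<open>0\<close> is the no-purchase option. A parameter vector
  \<open>v\<close> is a function on \<open>{0..N}\<close>; \<open>r i\<close> is the revenue of product \<open>i\<close>.
\<close>

definition assortments :: "nat \<Rightarrow> nat \<Rightarrow> nat set set" where
  "assortments N K = {S. S \<subseteq> {1..N} \<and> card S \<le> K}"

definition revenue :: "(nat \<Rightarrow> real) \<Rightarrow> (nat \<Rightarrow> real) \<Rightarrow> nat set \<Rightarrow> real" where
  "revenue r v S = (\<Sum>i\<in>S. r i * v i / (v 0 + (\<Sum>j\<in>S. v j)))"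

definition opt_assortment :: "nat \<Rightarrow> nat \<Rightarrow> (nat \<Rightarrow> real) \<Rightarrow> (nat \<Rightarrow> real) \<Rightarrow> nat set" where
  "opt_assortment N K r v = arg_max (revenue r v) (\<lambda>S. S \<in> assortments N K)"

definition choice_prob :: "(nat \<Rightarrow> real) \<Rightarrow> nat set \<Rightarrow> nat \<Rightarrow> real" where
  "choice_prob v S i = (if i \<in> insert 0 S then v i / (v 0 + (\<Sum>j\<in>S. v j)) else 0)"

text \<open>
  The \<open>else\<close> branch only gives a definite value outside the parameters allowed by
  \<open>mnl_instance\<close> below, where \<open>embed_pmf\<close> would be unspecified
  (and hence not provably measurable in \<open>v\<close>).
\<close>

definition choice_pmf :: "(nat \<Rightarrow> real) \<Rightarrow> nat set \<Rightarrow> nat pmf" where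
  "choice_pmf v S =
     (if 0 < v 0 \<and> (\<forall>i\<in>S. 0 \<le> v i) then embed_pmf (choice_prob v S) else return_pmf 0)"

text \<open>
  A history is the list of pairs (assortment offered, option chosen), oldest first. A policy maps
  the value of the exogenous variable \<open>U\<close> and the history so far to the next assortment; the
  time index is the length of the history. \<open>history_pmf p u v t\<close> is the law of the history of
  the first \<open>t\<close> periods given \<open>U = u\<close> and the parameter vector \<open>v\<close>.
\<close>

type_synonym history = "(nat set \<times> nat) list"
type_synonym policy = "real \<Rightarrow> history \<Rightarrow> nat set"

primrec history_pmf :: "policy \<Rightarrow> real \<Rightarrow> (nat \<Rightarrow> real) \<Rightarrow> nat \<Rightarrow> history pmf" where
  "history_pmf p u v 0 = return_pmf []"
| "history_pmf p u v (Suc t) =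
     bind_pmf (history_pmf p u v t)
       (\<lambda>h. map_pmf (\<lambda>c. h @ [(p u h, c)]) (choice_pmf v (p u h)))"

text \<open>\<open>\<mu>\<close> is the law of \<open>U\<close>; it is part of the policy and may be any Borel law.\<close>

definition admissible_policy :: "nat \<Rightarrow> nat \<Rightarrow> real measure \<Rightarrow> policy \<Rightarrow> bool" where
  "admissible_policy N K \<mu> p \<longleftrightarrow>
     prob_space \<mu> \<and> sets \<mu> = sets borel \<and>
     (\<forall>h. (\<lambda>u. p u h) \<in> measurable \<mu> (count_space (assortments N K)))"

text \<open>
  \<open>D\<close> is the law of the random parameter vector; the revenues are deterministic because the
  seller knows them. They are normalised to \<open>[0,1]\<close>, since the regret scales linearly in \<open>r\<close>
  and a bound with an absolute constant would otherwise be vacuous.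
\<close>

definition mnl_instance :: "nat \<Rightarrow> (nat \<Rightarrow> real) \<Rightarrow> (nat \<Rightarrow> real) measure \<Rightarrow> bool" where
  "mnl_instance N r D \<longleftrightarrow>
     (\<forall>i\<in>{1..N}. 0 \<le> r i \<and> r i \<le> 1) \<and>
     prob_space D \<and> sets D = sets (PiM {0..N} (\<lambda>_. borel)) \<and>
     (AE v in D. \<forall>i\<in>{0..N}. 0 < v i)"

text \<open>The product measure expresses that \<open>U\<close> is independent of the parameter vector.\<close>

definition regret ::
  "nat \<Rightarrow> nat \<Rightarrow> (nat \<Rightarrow> real) \<Rightarrow> (nat \<Rightarrow> real) measure \<Rightarrow> real measure \<Rightarrow> policy \<Rightarrow> nat \<Rightarrow> real"
where
  "regret N K r D \<mu> p T =
     (\<integral>(v, u). measure_pmf.expectation (history_pmf p u v T)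
        (\<lambda>h. \<Sum>t<T. revenue r v (opt_assortment N K r v) - revenue r v (fst (h ! t)))
      \<partial>(D \<Otimes>\<^sub>M \<mu>))"

lemma finite_assortments: "finite (assortments N K)"
  by (rule finite_subset[of _ "Pow {1..N}"]) (auto simp: assortments_def)

lemma opt_assortment_in: "opt_assortment N K r v \<in> assortments N K"
  and revenue_le_opt:
    "S \<in> assortments N K \<Longrightarrow> revenue r v S \<le> revenue r v (opt_assortment N K r v)"
proof -
  let ?F = "revenue r v ` assortments N K"
  have ne: "{} \<in> assortments N K" by (simp add: assortments_def)
  have fin: "finite ?F" by (simp add: finite_assortments)
  have "Max ?F \<in> ?F" using ne fin by (intro Max_in) auto
  then obtain X where X: "X \<in> assortments N K" "revenue r v X = Max ?F" by auto
  have "is_arg_max (revenue r v) (\<lambda>S. S \<in> assortments N K) X"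
    using X fin by (auto simp: is_arg_max_linorder)
  then have *: "is_arg_max (revenue r v) (\<lambda>S. S \<in> assortments N K) (opt_assortment N K r v)"
    unfolding opt_assortment_def arg_max_def by (rule someI)
  show "opt_assortment N K r v \<in> assortments N K"
    using * by (simp add: is_arg_max_def)
  show "S \<in> assortments N K \<Longrightarrow> revenue r v S \<le> revenue r v (opt_assortment N K r v)"
    using * by (simp add: is_arg_max_linorder)
qed

lemma pmf_choice_pmf:
  assumes S: "S \<in> assortments N K" and v0: "0 < v 0" and v: "\<forall>i\<in>S. 0 \<le> v i"
  shows "pmf (choice_pmf v S) i = choice_prob v S i"
proof -
  have fin: "finite S" and n0: "0 \<notin> S"
    using S by (auto simp: assortments_def intro: finite_subset)
  have pos: "0 < v 0 + sum v S" using v0 v by (simp add: add_pos_nonneg sum_nonneg)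
  have nn: "0 \<le> choice_prob v S x" for x
    using v0 v pos by (auto simp: choice_prob_def intro!: divide_nonneg_pos)
  have "(\<integral>\<^sup>+x. ennreal (choice_prob v S x) \<partial>count_space UNIV)
      = (\<Sum>x\<in>insert 0 S. ennreal (choice_prob v S x))"
    by (rule nn_integral_count_space'[where A = "insert 0 S"])
       (use fin in \<open>auto simp: choice_prob_def\<close>)
  also have "\<dots> = ennreal (\<Sum>x\<in>insert 0 S. choice_prob v S x)"
    using nn by simp
  also have "(\<Sum>x\<in>insert 0 S. choice_prob v S x) = (\<Sum>x\<in>insert 0 S. v x / (v 0 + sum v S))"
    by (intro sum.cong) (auto simp: choice_prob_def)
  also have "\<dots> = 1"
    using fin n0 pos by (simp flip: sum_divide_distrib add_divide_distrib)
  finally have "pmf (embed_pmf (choice_prob v S)) i = choice_prob v S i"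
    by (intro pmf_embed_pmf) (use nn in auto)
  then show ?thesis using v0 v by (simp add: choice_pmf_def)
qed

end

theory Submission
  imports Defs
begin

text \<open>
  The parameter vector is uniform on \<open>M\<close> perturbations \<open>w j\<close> of a base vector \<open>w\<^sub>0\<close>.
  Under \<open>w j\<close> an assortment \<open>S\<close> loses at least a multiple of \<open>\<epsilon> (1 - f j S)\<close>, where
  \<open>\<Sum>j. f j S \<le> 1\<close>, while one observation under \<open>S\<close> yields divergences from the base
  that sum over \<open>j\<close> to \<open>O(\<epsilon>\<^sup>2)\<close>. By the chain rule for the Kullback-Leibler
  divergence, \<open>T\<close> observations do not identify \<open>j\<close> if \<open>\<epsilon>\<close> is a small multiple of
  \<open>sqrt (M / T)\<close>, and the regret is of order \<open>\<epsilon> T = sqrt (M T)\<close>.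

  For \<open>2 K \<le> N\<close> the products are split into \<open>M = N div K\<close> blocks of size \<open>K\<close>, all
  revenues are \<open>1\<close>, block \<open>j\<close> is more attractive by a factor \<open>1 + \<epsilon>\<close>, and \<open>f j S\<close> is
  the fraction of block \<open>j\<close> that \<open>S\<close> contains. For \<open>2 K > N\<close> it is enough to have
  \<open>M = 2\<close>: product \<open>2\<close> has revenue \<open>1 / 3\<close>, which is the revenue of the assortment
  \<open>{1}\<close> under the base vector, so whether \<open>2\<close> should join product \<open>1\<close> depends on the
  sign of the perturbation of the attraction of product \<open>1\<close>.
\<close>

lemma assortmentsD:
  assumes "S \<in> assortments N K"
  shows "finite S" "0 \<notin> S" "S \<subseteq> {0..N}" "insert 0 S \<subseteq> {0..N}" "card S \<le> K"
  using assms by (auto simp: assortments_def intro: finite_subset)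

lemma pmf_choice_pmf_pos:
  assumes "S \<in> assortments N K" "\<forall>i\<in>{0..N}. 0 < v i"
  shows "pmf (choice_pmf v S) = choice_prob v S"
    and "set_pmf (choice_pmf v S) = insert 0 S"
    and "\<And>c. c \<in> insert 0 S \<Longrightarrow> 0 < choice_prob v S c"
    and "(\<Sum>c\<in>insert 0 S. choice_prob v S c) = 1"
proof -
  note S = assortmentsD[OF assms(1)]
  have pos: "0 < v i" if "i \<in> insert 0 S" for i using that S assms(2) by blast
  show eq: "pmf (choice_pmf v S) = choice_prob v S"
    using pmf_choice_pmf[OF assms(1)] pos by (auto simp: less_imp_le)
  have "0 < v 0 + sum v S"
    using pos by (simp add: add_pos_nonneg sum_nonneg less_imp_le)
  then show pp: "0 < choice_prob v S c" if "c \<in> insert 0 S" for c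
    using pos[OF that] that by (auto simp: choice_prob_def)
  then show set: "set_pmf (choice_pmf v S) = insert 0 S"
    by (force simp: set_pmf_eq eq choice_prob_def[of v S x for x])
  show "(\<Sum>c\<in>insert 0 S. choice_prob v S c) = 1"
    using sum_pmf_eq_1[of "insert 0 S" "choice_pmf v S"] S(1) by (simp add: set eq)
qed

lemma set_choice_pmf_subset:
  assumes "S \<in> assortments N K"
  shows "set_pmf (choice_pmf v S) \<subseteq> insert 0 S"
proof (cases "0 < v 0 \<and> (\<forall>i\<in>S. 0 \<le> v i)")
  case True
  then show ?thesis
    using pmf_choice_pmf[OF assms] by (auto simp: set_pmf_eq choice_prob_def)
qed (auto simp: choice_pmf_def)

lemma finite_histories: "finite {h. set h \<subseteq> assortments N K \<times> {0..N} \<and> length h = t}"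
  by (intro finite_lists_length_eq finite_cartesian_product finite_assortments) simp

definition chi_square :: "(nat \<Rightarrow> real) \<Rightarrow> (nat \<Rightarrow> real) \<Rightarrow> nat set \<Rightarrow> real" where
  "chi_square a b S = (\<Sum>c\<in>insert 0 S. (choice_prob a S c)\<^sup>2 / choice_prob b S c) - 1"

definition log_likelihood :: "(nat \<Rightarrow> real) \<Rightarrow> (nat \<Rightarrow> real) \<Rightarrow> history \<Rightarrow> real" where
  "log_likelihood a b h = (\<Sum>(S, c)\<leftarrow>h. ln (choice_prob b S c / choice_prob a S c))"

lemma log_likelihood_simps:
  "log_likelihood a b [] = 0"
  "log_likelihood a b (h @ [(S, c)]) =
     log_likelihood a b h + ln (choice_prob b S c / choice_prob a S c)"
  by (simp_all add: log_likelihood_def)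

text \<open>
  Applied to a log-likelihood ratio \<open>l\<close>, this replaces Pinsker's inequality: after taking
  expectations, \<open>exp l - 1\<close> vanishes and \<open>- l\<close> becomes the divergence.
\<close>

lemma likelihood_tilt_bound:
  fixes F \<eta> l :: real
  assumes F: "0 \<le> F" "F \<le> 1" and \<eta>: "0 < \<eta>"
  shows "exp l * F \<le> F + (exp l - 1) + \<eta> + (exp l - 1 - l) / \<eta>"
proof -
  define s where "s = exp (l / 2)"
  have s: "0 < s" "exp l = s\<^sup>2" "l / 2 \<le> s - 1"
    using exp_ge_add_one_self[of "l / 2"]
    by (simp add: s_def, simp add: s_def power2_eq_square flip: exp_add, unfold s_def, linarith)
  have 1: "(s - 1)\<^sup>2 \<le> exp l - 1 - l"
    using s by (simp add: power2_eq_square algebra_simps)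
  have "(exp l - 1) * (F - 1) \<le> \<eta> + (exp l - 1 - l) / \<eta>"
  proof (cases "exp l \<ge> 1")
    case True
    then have "(exp l - 1) * (F - 1) \<le> 0" using F by (simp add: mult_nonneg_nonpos)
    also have "0 \<le> \<eta> + (exp l - 1 - l) / \<eta>"
      using 1 \<eta> zero_le_power2[of "s - 1"] by (intro add_nonneg_nonneg divide_nonneg_pos) linarith+
    finally show ?thesis .
  next
    case False
    have "(exp l - 1) * (F - 1) \<le> 1 - exp l"
      using mult_right_mono[of "1 - F" 1 "1 - exp l"] F False by (simp add: algebra_simps)
    also have "1 - exp l \<le> 2 * (1 - s)"
      using zero_le_power2[of "1 - s"] by (simp add: s power2_eq_square algebra_simps)
    also have "2 * (1 - s) \<le> \<eta> + (s - 1)\<^sup>2 / \<eta>"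
      using \<eta> zero_le_power2[of "\<eta> - (1 - s)"] by (simp add: field_simps power2_eq_square)
    also have "\<dots> \<le> \<eta> + (exp l - 1 - l) / \<eta>" using 1 \<eta> by (simp add: divide_right_mono)
    finally show ?thesis .
  qed
  then show ?thesis by (simp add: algebra_simps)
qed

locale history_process =
  fixes N K :: nat and p :: policy and u :: real
  assumes offers: "p u h \<in> assortments N K"
begin

lemma set_history_pmf:
  shows "set_pmf (history_pmf p u v t)
    \<subseteq> {h. set h \<subseteq> assortments N K \<times> {0..N} \<and> length h = t}"
proof (induction t)
  case (Suc t)
  then show ?case
    using offers set_choice_pmf_subset[OF offers, of v] assortmentsD(4)[OF offers]
    by (fastforce simp: set_bind_pmf)
qed simp

lemma finite_set_history_pmf:
  shows "finite (set_pmf (history_pmf p u v t))"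
  using finite_subset[OF set_history_pmf finite_histories] .

lemma integrable_history_pmf:
  fixes F :: "history \<Rightarrow> real"
  shows "integrable (measure_pmf (history_pmf p u v t)) F"
  by (rule integrable_measure_pmf_finite[OF finite_set_history_pmf])

lemma expectation_history_Suc:
  fixes F :: "history \<Rightarrow> real"
  assumes v: "\<forall>i\<in>{0..N}. 0 < v i"
  shows "measure_pmf.expectation (history_pmf p u v (Suc t)) F =
    measure_pmf.expectation (history_pmf p u v t)
      (\<lambda>h. \<Sum>c\<in>insert 0 (p u h). choice_prob v (p u h) c * F (h @ [(p u h, c)]))"
proof -
  let ?P = "history_pmf p u v t"
  have fin: "finite (set_pmf ?P)" by (rule finite_set_history_pmf)
  note c = pmf_choice_pmf_pos[OF offers v] and S = assortmentsD[OF offers]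
  have "measure_pmf.expectation (history_pmf p u v (Suc t)) F
      = (\<Sum>h\<in>set_pmf ?P. pmf ?P h *\<^sub>R measure_pmf.expectation
          (map_pmf (\<lambda>c. h @ [(p u h, c)]) (choice_pmf v (p u h))) F)"
    unfolding history_pmf.simps
    by (rule pmf_expectation_bind[OF fin]) (use c(2) S(1) in auto)
  also have "\<dots> = measure_pmf.expectation ?P (\<lambda>h. measure_pmf.expectation
          (map_pmf (\<lambda>c. h @ [(p u h, c)]) (choice_pmf v (p u h))) F)"
    by (subst integral_measure_pmf[OF fin]) (auto simp: mult.commute)
  also have "\<dots> = measure_pmf.expectation ?P
      (\<lambda>h. \<Sum>c\<in>insert 0 (p u h). choice_prob v (p u h) c * F (h @ [(p u h, c)]))"
  proof (rule Bochner_Integration.integral_cong[OF refl])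
    fix h
    have "measure_pmf.expectation (choice_pmf v (p u h)) (\<lambda>c. F (h @ [(p u h, c)]))
      = (\<Sum>c\<in>insert 0 (p u h). F (h @ [(p u h, c)]) * pmf (choice_pmf v (p u h)) c)"
      by (rule integral_measure_pmf_real) (use c(2) S(1) in auto)
    then show "measure_pmf.expectation
          (map_pmf (\<lambda>c. h @ [(p u h, c)]) (choice_pmf v (p u h))) F
        = (\<Sum>c\<in>insert 0 (p u h). choice_prob v (p u h) c * F (h @ [(p u h, c)]))"
      by (simp add: c(1) mult.commute del: sum.insert)
  qed
  finally show ?thesis .
qed

lemma history_change_of_measure:
  fixes F :: "history \<Rightarrow> real"
  assumes a: "\<forall>i\<in>{0..N}. 0 < a i" and b: "\<forall>i\<in>{0..N}. 0 < b i"
  shows "measure_pmf.expectation (history_pmf p u b t) F =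
    measure_pmf.expectation (history_pmf p u a t) (\<lambda>h. exp (log_likelihood a b h) * F h)"
proof (induction t arbitrary: F)
  case (Suc t)
  note ca = pmf_choice_pmf_pos(3)[OF offers a] and cb = pmf_choice_pmf_pos(3)[OF offers b]
  have tilt: "x * (choice_prob b (p u h) c * y) = choice_prob a (p u h) c *
      (x * exp (ln (choice_prob b (p u h) c / choice_prob a (p u h) c)) * y)"
    if "c \<in> insert 0 (p u h)" for h c x y
    using ca[OF that] cb[OF that] by simp
  have "exp (log_likelihood a b h) *
        (\<Sum>c\<in>insert 0 (p u h). choice_prob b (p u h) c * F (h @ [(p u h, c)])) =
      (\<Sum>c\<in>insert 0 (p u h). choice_prob a (p u h) c *
        (exp (log_likelihood a b (h @ [(p u h, c)])) * F (h @ [(p u h, c)])))" for h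
    unfolding sum_distrib_left log_likelihood_simps exp_add
    by (intro sum.cong refl tilt)
  then show ?case
    by (simp add: expectation_history_Suc[OF a] expectation_history_Suc[OF b] Suc.IH
        del: sum.insert history_pmf.simps)
qed (simp add: log_likelihood_simps)

lemma expectation_log_likelihood:
  assumes a: "\<forall>i\<in>{0..N}. 0 < a i" and b: "\<forall>i\<in>{0..N}. 0 < b i"
  shows "measure_pmf.expectation (history_pmf p u a t) (\<lambda>h. - log_likelihood a b h) \<le>
    measure_pmf.expectation (history_pmf p u a t) (\<lambda>h. \<Sum>(S, c)\<leftarrow>h. chi_square a b S)"
proof (induction t)
  case (Suc t)
  let ?P = "history_pmf p u a t"
  let ?X = "\<lambda>h. \<Sum>(S, c)\<leftarrow>h. chi_square a b S"
  note pa = pmf_choice_pmf_pos(3,4)[OF offers a] and pb = pmf_choice_pmf_pos(3,4)[OF offers b]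
  note int = integrable_history_pmf
  have step: "(\<Sum>c\<in>insert 0 (p u h). choice_prob a (p u h) c *
      - log_likelihood a b (h @ [(p u h, c)])) \<le> - log_likelihood a b h + chi_square a b (p u h)"
    for h
  proof -
    let ?a = "choice_prob a (p u h)" and ?b = "choice_prob b (p u h)"
    have "?a c * - ln (?b c / ?a c) \<le> (?a c)\<^sup>2 / ?b c - ?a c" if "c \<in> insert 0 (p u h)" for c
    proof -
      have pos: "0 < ?a c" "0 < ?b c" using pa(1) pb(1) that by auto
      then have "- ln (?b c / ?a c) \<le> ?a c / ?b c - 1"
        using ln_le_minus_one[of "?a c / ?b c"] by (simp add: ln_div)
      from mult_left_mono[OF this, of "?a c"] pos show ?thesis
        by (simp add: power2_eq_square algebra_simps)
    qed
    then have "(\<Sum>c\<in>insert 0 (p u h). ?a c * - ln (?b c / ?a c))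
        \<le> (\<Sum>c\<in>insert 0 (p u h). (?a c)\<^sup>2 / ?b c - ?a c)" by (rule sum_mono)
    also have "\<dots> = chi_square a b (p u h)"
      by (simp only: chi_square_def sum_subtractf pa(2))
    finally have le: "(\<Sum>c\<in>insert 0 (p u h). ?a c * - ln (?b c / ?a c)) \<le> chi_square a b (p u h)" .
    have "(\<Sum>c\<in>insert 0 (p u h). ?a c * - log_likelihood a b (h @ [(p u h, c)])) =
       (\<Sum>c\<in>insert 0 (p u h). ?a c) * - log_likelihood a b h
       + (\<Sum>c\<in>insert 0 (p u h). ?a c * - ln (?b c / ?a c))"
      unfolding log_likelihood_simps sum_distrib_right sum.distrib[symmetric]
      by (intro sum.cong refl) (simp add: algebra_simps)
    then show ?thesis using le by (simp only: pa(2))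
  qed
  have X: "(\<Sum>c\<in>insert 0 (p u h). choice_prob a (p u h) c * ?X (h @ [(p u h, c)])) =
      ?X h + chi_square a b (p u h)" for h
    by (simp add: sum_distrib_right[symmetric] pa(2) del: sum.insert)
  have "measure_pmf.expectation (history_pmf p u a (Suc t)) (\<lambda>h. - log_likelihood a b h)
      \<le> measure_pmf.expectation ?P (\<lambda>h. - log_likelihood a b h + chi_square a b (p u h))"
    unfolding expectation_history_Suc[OF a] by (intro integral_mono int step)
  also have "\<dots> \<le> measure_pmf.expectation ?P ?X
      + measure_pmf.expectation ?P (\<lambda>h. chi_square a b (p u h))"
    using Suc.IH by (subst Bochner_Integration.integral_add[OF int int]) simp
  also have "\<dots> = measure_pmf.expectation (history_pmf p u a (Suc t)) ?X"
    unfolding expectation_history_Suc[OF a] X by (rule Bochner_Integration.integral_add[OF int int, symmetric])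
  finally show ?case .
qed (simp add: log_likelihood_simps)

lemma expectation_shift_bound:
  fixes F :: "history \<Rightarrow> real"
  assumes a: "\<forall>i\<in>{0..N}. 0 < a i" and b: "\<forall>i\<in>{0..N}. 0 < b i"
    and F: "\<And>h. h \<in> set_pmf (history_pmf p u a t) \<Longrightarrow> 0 \<le> F h \<and> F h \<le> 1" and \<eta>: "0 < \<eta>"
  shows "measure_pmf.expectation (history_pmf p u b t) F \<le>
    measure_pmf.expectation (history_pmf p u a t) F + \<eta> +
    measure_pmf.expectation (history_pmf p u a t) (\<lambda>h. \<Sum>(S, c)\<leftarrow>h. chi_square a b S) / \<eta>"
proof -
  let ?P = "history_pmf p u a t" and ?l = "log_likelihood a b"
  let ?E = "measure_pmf.expectation ?P"
  note int = integrable_history_pmf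
  have L: "?E (\<lambda>h. exp (?l h)) = 1"
    using history_change_of_measure[OF a b, of t "\<lambda>_. 1"] by simp
  have "measure_pmf.expectation (history_pmf p u b t) F = ?E (\<lambda>h. exp (?l h) * F h)"
    by (rule history_change_of_measure[OF a b])
  also have "\<dots> \<le> ?E (\<lambda>h. F h + (exp (?l h) - 1) + \<eta> + (exp (?l h) - 1 - ?l h) / \<eta>)"
    using F \<eta> by (intro integral_mono_AE int) (auto simp: AE_measure_pmf_iff intro!: likelihood_tilt_bound)
  also have "\<dots> = ?E F + \<eta> + ?E (\<lambda>h. - ?l h) / \<eta>"
    by (simp add: int L)
  also have "\<dots> \<le> ?E F + \<eta> + ?E (\<lambda>h. \<Sum>(S, c)\<leftarrow>h. chi_square a b S) / \<eta>"
    using expectation_log_likelihood[OF a b, of t] \<eta> by (intro add_mono divide_right_mono) auto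
  finally show ?thesis .
qed

end

lemma chi_square_scaled_le:
  assumes S: "S \<in> assortments N K" and a: "\<forall>i\<in>{0..N}. 0 < a i"
    and \<delta>: "-1 < \<delta>" and G: "0 \<notin> G"
    and b: "\<And>i. i \<in> insert 0 S \<Longrightarrow> b i = (if i \<in> G then (1 + \<delta>) * a i else a i)"
  shows "chi_square a b S \<le> \<delta>\<^sup>2 / (1 + \<delta>) * sum a (S \<inter> G) / (a 0 + sum a S)"
proof -
  note S' = assortmentsD[OF S]
  define A where "A = a 0 + sum a S"
  define g where "g = sum a (S \<inter> G)"
  have pos: "0 < a i" if "i \<in> insert 0 S" for i using that S' a by blast
  have A: "0 < A" and g: "0 \<le> g"
    unfolding A_def g_def using pos by (auto intro!: add_pos_nonneg sum_nonneg simp: less_imp_le)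
  have split: "sum f S = sum f (S \<inter> G) + sum f (S - G)" for f :: "nat \<Rightarrow> real"
    using sum.Int_Diff[OF S'(1)] .
  have B: "b 0 + sum b S = A + \<delta> * g"
    unfolding A_def g_def split[of b] split[of a] using G b
    by (simp add: sum_distrib_left algebra_simps sum.distrib)
  have quad: "(\<Sum>c\<in>insert 0 S. (a c)\<^sup>2 / b c) = A - \<delta> / (1 + \<delta>) * g"
  proof -
    have "(\<Sum>c\<in>S \<inter> G. (a c)\<^sup>2 / b c) = (\<Sum>c\<in>S \<inter> G. a c / (1 + \<delta>))"
      by (intro sum.cong refl) (use pos b \<delta> in \<open>force simp: power2_eq_square\<close>)
    moreover have "(\<Sum>c\<in>S - G. (a c)\<^sup>2 / b c) = sum a (S - G)"
      by (intro sum.cong refl) (use pos b in \<open>auto simp: power2_eq_square\<close>)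
    moreover have "(a 0)\<^sup>2 / b 0 = a 0" using b[of 0] G by (simp add: power2_eq_square)
    ultimately show ?thesis
      unfolding A_def g_def split[of a]
      using S' \<delta> by (simp add: split[of "\<lambda>c. (a c)\<^sup>2 / b c"] sum_divide_distrib[symmetric] field_simps)
  qed
  have "chi_square a b S = (\<Sum>c\<in>insert 0 S. (a c)\<^sup>2 / b c * ((A + \<delta> * g) / A\<^sup>2)) - 1"
    unfolding chi_square_def
    by (intro arg_cong2[where f = minus] sum.cong refl)
       (auto simp: choice_prob_def B A_def[symmetric] power_divide)
  also have "\<dots> = (A - \<delta> / (1 + \<delta>) * g) * ((A + \<delta> * g) / A\<^sup>2) - 1"
    by (simp only: sum_distrib_right[symmetric] quad)
  also have "\<dots> = \<delta>\<^sup>2 / (1 + \<delta>) * g / A - \<delta>\<^sup>2 / (1 + \<delta>) * (g / A)\<^sup>2"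
  proof -
    define q where "q = \<delta> / (1 + \<delta>)"
    have q: "\<delta>\<^sup>2 / (1 + \<delta>) = \<delta> * q" "q = \<delta> - \<delta> * q"
      using \<delta> by (simp_all add: q_def field_simps power2_eq_square)
    have "(A - q * g) * (A + \<delta> * g) = A\<^sup>2 + (\<delta> - q) * g * A - \<delta> * q * g\<^sup>2"
      by (simp add: algebra_simps power2_eq_square)
    moreover have "\<delta> - q = \<delta> * q" using q(2) by linarith
    ultimately have "(A - q * g) * ((A + \<delta> * g) / A\<^sup>2) =
        (A\<^sup>2 + \<delta> * q * g * A - \<delta> * q * g\<^sup>2) / A\<^sup>2"
      by (simp only: times_divide_eq_right)
    then show ?thesis
      using A unfolding q(1) q_def[symmetric]
      by (simp only: diff_divide_distrib add_divide_distrib) (simp add: power2_eq_square)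
  qed
  also have "\<dots> \<le> \<delta>\<^sup>2 / (1 + \<delta>) * g / A" using \<delta> by simp
  finally show ?thesis by (simp add: A_def g_def)
qed

lemma sum_list_history_eq:
  assumes "length h = t"
  shows "(\<Sum>(S, c)\<leftarrow>h. g S) = (\<Sum>i<t. g (fst (h ! i)))"
  using assms by (simp add: sum_list_sum_nth atLeast0LessThan case_prod_beta)

context history_process
begin

lemma expected_gap_sum_bound:
  fixes w\<^sub>0 :: "nat \<Rightarrow> real" and w :: "nat \<Rightarrow> nat \<Rightarrow> real" and f gap :: "nat \<Rightarrow> nat set \<Rightarrow> real"
  assumes w\<^sub>0: "\<forall>i\<in>{0..N}. 0 < w\<^sub>0 i" and w: "\<And>j. j < M \<Longrightarrow> \<forall>i\<in>{0..N}. 0 < w j i"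
    and f: "\<And>j S. j < M \<Longrightarrow> S \<in> assortments N K \<Longrightarrow> 0 \<le> f j S \<and> f j S \<le> 1"
    and f_sum: "\<And>S. S \<in> assortments N K \<Longrightarrow> (\<Sum>j<M. f j S) \<le> 1"
    and chi: "\<And>S. S \<in> assortments N K \<Longrightarrow> (\<Sum>j<M. chi_square w\<^sub>0 (w j) S) \<le> \<kappa>"
    and gap: "\<And>j S. j < M \<Longrightarrow> S \<in> assortments N K \<Longrightarrow> c * (1 - f j S) \<le> gap j S"
    and c: "0 \<le> c" and M: "2 \<le> M" and T: "0 < T" and \<kappa>: "64 * T * \<kappa> \<le> M"
  shows "c * T * M / 4 \<le>
    (\<Sum>j<M. measure_pmf.expectation (history_pmf p u (w j) T) (\<lambda>h. \<Sum>t<T. gap j (fst (h ! t))))"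
proof -
  define F where "F j h = (\<Sum>t<T. f j (fst (h ! t))) / T" for j and h :: history
  let ?E = "\<lambda>j (g :: history \<Rightarrow> real). measure_pmf.expectation (history_pmf p u (w j) T) g"
  let ?B = "\<lambda>g :: history \<Rightarrow> real. measure_pmf.expectation (history_pmf p u w\<^sub>0 T) g"
  note int = integrable_history_pmf
  have supp: "length h = T \<and> (\<forall>t<T. fst (h ! t) \<in> assortments N K)"
    if "h \<in> set_pmf (history_pmf p u v T)" for h v
    using set_mp[OF set_history_pmf that] by (auto dest!: nth_mem)
  have F01: "0 \<le> F j h \<and> F j h \<le> 1" if "j < M" "h \<in> set_pmf (history_pmf p u v T)" for j h v
  proof -
    have "(\<Sum>t<T. f j (fst (h ! t))) \<le> (\<Sum>t<T. 1)" "0 \<le> (\<Sum>t<T. f j (fst (h ! t)))"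
      using supp[OF that(2)] f[OF that(1)]
      by (intro sum_mono sum_nonneg; simp)+
    then show ?thesis using T by (simp add: F_def)
  qed
  have E0F: "(\<Sum>j<M. ?B (F j)) \<le> 1"
  proof -
    have "(\<Sum>j<M. F j h) \<le> 1" if "h \<in> set_pmf (history_pmf p u w\<^sub>0 T)" for h
    proof -
      have "(\<Sum>j<M. F j h) = (\<Sum>t<T. \<Sum>j<M. f j (fst (h ! t))) / T"
        unfolding F_def sum_divide_distrib[symmetric] by (subst sum.swap) simp
      also have "(\<Sum>t<T. \<Sum>j<M. f j (fst (h ! t))) \<le> (\<Sum>t<T. 1)"
        using supp[OF that] f_sum by (intro sum_mono) auto
      finally show ?thesis using T by (simp add: divide_right_mono)
    qed
    then have "?B (\<lambda>h. \<Sum>j<M. F j h) \<le> ?B (\<lambda>_. 1)"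
      by (intro integral_mono_AE int) (simp add: AE_measure_pmf_iff)
    then show ?thesis by (simp add: int)
  qed
  have E0chi: "(\<Sum>j<M. ?B (\<lambda>h. \<Sum>(S, c)\<leftarrow>h. chi_square w\<^sub>0 (w j) S)) \<le> T * \<kappa>"
  proof -
    have "(\<Sum>j<M. \<Sum>(S, c)\<leftarrow>h. chi_square w\<^sub>0 (w j) S) \<le> T * \<kappa>"
      if "h \<in> set_pmf (history_pmf p u w\<^sub>0 T)" for h
    proof -
      have "(\<Sum>j<M. \<Sum>(S, c)\<leftarrow>h. chi_square w\<^sub>0 (w j) S)
          = (\<Sum>t<T. \<Sum>j<M. chi_square w\<^sub>0 (w j) (fst (h ! t)))"
        using supp[OF that] by (subst sum.swap) (simp add: sum_list_history_eq)
      also have "\<dots> \<le> (\<Sum>t<T. \<kappa>)" using supp[OF that] chi by (intro sum_mono) auto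
      finally show ?thesis by simp
    qed
    then have "?B (\<lambda>h. \<Sum>j<M. \<Sum>(S, c)\<leftarrow>h. chi_square w\<^sub>0 (w j) S) \<le> ?B (\<lambda>_. T * \<kappa>)"
      by (intro integral_mono_AE int) (simp add: AE_measure_pmf_iff)
    then show ?thesis by (simp add: int)
  qed
  have "(\<Sum>j<M. ?E j (F j)) \<le>
      (\<Sum>j<M. ?B (F j) + 1/8 + ?B (\<lambda>h. \<Sum>(S, c)\<leftarrow>h. chi_square w\<^sub>0 (w j) S) / (1/8))"
    by (intro sum_mono expectation_shift_bound w\<^sub>0 w F01) auto
  also have "\<dots> = (\<Sum>j<M. ?B (F j)) + M / 8 +
      8 * (\<Sum>j<M. ?B (\<lambda>h. \<Sum>(S, c)\<leftarrow>h. chi_square w\<^sub>0 (w j) S))"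
    by (simp add: sum.distrib sum_distrib_left mult.commute)
  also have "\<dots> \<le> 1 + M / 8 + 8 * (T * \<kappa>)"
    using E0F E0chi by linarith
  also have "\<dots> \<le> 3 * M / 4" using M \<kappa> by (simp add: field_simps)
  finally have EF: "(\<Sum>j<M. ?E j (F j)) \<le> 3 * M / 4" .
  have "?E j (\<lambda>h. \<Sum>t<T. gap j (fst (h ! t))) \<ge> c * T * (1 - ?E j (F j))" if j: "j < M" for j
  proof -
    have "c * T * (1 - F j h) \<le> (\<Sum>t<T. gap j (fst (h ! t)))"
      if "h \<in> set_pmf (history_pmf p u (w j) T)" for h
    proof -
      have "c * T * (1 - F j h) = (\<Sum>t<T. c * (1 - f j (fst (h ! t))))"
        using T by (simp add: F_def sum_distrib_left[symmetric] sum_subtractf field_simps)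
      also have "\<dots> \<le> (\<Sum>t<T. gap j (fst (h ! t)))"
        using supp[OF that] gap[OF j] by (intro sum_mono) auto
      finally show ?thesis .
    qed
    then have "?E j (\<lambda>h. c * T * (1 - F j h)) \<le> ?E j (\<lambda>h. \<Sum>t<T. gap j (fst (h ! t)))"
      by (intro integral_mono_AE int) (simp add: AE_measure_pmf_iff)
    then show ?thesis by (simp add: int)
  qed
  then have "(\<Sum>j<M. c * T * (1 - ?E j (F j))) \<le>
      (\<Sum>j<M. ?E j (\<lambda>h. \<Sum>t<T. gap j (fst (h ! t))))"
    by (intro sum_mono) auto
  moreover have "(\<Sum>j<M. c * T * (1 - ?E j (F j))) = c * T * (M - (\<Sum>j<M. ?E j (F j)))"
    by (simp add: sum_distrib_left[symmetric] sum_subtractf)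
  moreover have "c * T * (M / 4) \<le> c * T * (M - (\<Sum>j<M. ?E j (F j)))"
    using EF c by (intro mult_left_mono) auto
  ultimately show ?thesis by simp
qed

end

lemma pmf_history_pmf:
  "pmf (history_pmf p u v t) h = (if length h = t then \<Prod>i<t.
     (if p u (take i h) = fst (h ! i) then pmf (choice_pmf v (fst (h ! i))) (snd (h ! i)) else 0)
   else 0)"
proof (induction t arbitrary: h)
  case (Suc t)
  let ?f = "\<lambda>x. map_pmf (\<lambda>c. x @ [(p u x, c)]) (choice_pmf v (p u x))"
  show ?case
  proof (cases h rule: rev_cases)
    case Nil
    then have "pmf (?f x) h = 0" for x by (auto simp: pmf_eq_0_set_pmf)
    with Nil show ?thesis by (simp add: pmf_bind)
  next
    case (snoc h' y)
    obtain S c where y: "y = (S, c)" by fastforce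
    define k where "k = (if p u h' = S then pmf (choice_pmf v S) c else 0)"
    have "pmf (?f x) h = indicator {h'} x * k" for x
    proof (cases "x = h' \<and> p u h' = S")
      case True
      then have "pmf (?f x) h = pmf (?f h') (h' @ [(p u h', c)])" by (simp add: snoc y)
      also have "\<dots> = pmf (choice_pmf v (p u h')) c"
        by (rule pmf_map_inj') (auto intro: injI)
      finally show ?thesis using True by (simp add: k_def)
    next
      case False
      then have "h \<notin> set_pmf (?f x)" by (auto simp: snoc y)
      then have "pmf (?f x) h = 0" by (simp add: pmf_eq_0_set_pmf)
      then show ?thesis using False by (auto simp: k_def indicator_def)
    qed
    then have "pmf (history_pmf p u v (Suc t)) h = pmf (history_pmf p u v t) h' * k"
      by (simp add: pmf_bind measure_pmf_single)
    then show ?thesis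
      by (simp add: Suc.IH snoc y k_def nth_append cong: if_cong)
  qed
qed (simp add: pmf_return)

lemma revenue_opt_eq_Max:
  "revenue r v (opt_assortment N K r v) = Max (revenue r v ` assortments N K)"
  using opt_assortment_in revenue_le_opt
  by (intro Max_eqI[symmetric]) (auto simp: finite_assortments)

lemma admissible_policy_offers:
  assumes "admissible_policy N K \<mu> p"
  shows "p u h \<in> assortments N K"
proof -
  have "sets \<mu> = sets borel" and p: "(\<lambda>u. p u h) \<in> measurable \<mu> (count_space (assortments N K))"
    using assms by (simp_all add: admissible_policy_def)
  then have "u \<in> space \<mu>" using sets_eq_imp_space_eq[of \<mu> borel] by simp
  then show ?thesis using measurable_space[OF p] by simp
qed

lemma measurable_regret_integrand:
  assumes adm: "admissible_policy N K \<mu> p"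
  shows "(\<lambda>(v, u). measure_pmf.expectation (history_pmf p u v T)
      (\<lambda>h. \<Sum>t<T. revenue r v (opt_assortment N K r v) - revenue r v (fst (h ! t))))
    \<in> borel_measurable (PiM {0..N} (\<lambda>_. borel) \<Otimes>\<^sub>M \<mu>)"
proof -
  let ?V = "PiM {0..N} (\<lambda>_. borel) :: (nat \<Rightarrow> real) measure"
  let ?H = "{h. set h \<subseteq> assortments N K \<times> {0..N} \<and> length h = T}"
  have p: "(\<lambda>u. p u h) \<in> measurable \<mu> (count_space (assortments N K))" for h
    using adm by (simp add: admissible_policy_def)
  have offers: "p u h \<in> assortments N K" for u h
    using adm by (rule admissible_policy_offers)
  have comp[measurable]: "(\<lambda>v. v i) \<in> borel_measurable ?V" if "i \<in> {0..N}" for i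
    using that by (rule measurable_component_singleton)
  have sub: "i \<in> {0..N}" if "S \<in> assortments N K" "i \<in> insert 0 S" for S i
    using assortmentsD(4)[OF that(1)] that(2) by blast
  have rev: "(\<lambda>v. revenue r v S) \<in> borel_measurable ?V" if "S \<in> assortments N K" for S
    unfolding revenue_def using sub[OF that]
    by (intro borel_measurable_sum borel_measurable_divide borel_measurable_times
        borel_measurable_add borel_measurable_const comp) auto
  have opt: "(\<lambda>v. revenue r v (opt_assortment N K r v)) \<in> borel_measurable ?V"
    unfolding revenue_opt_eq_Max by (intro borel_measurable_Max finite_assortments rev)
  have choice: "(\<lambda>v. pmf (choice_pmf v S) c) \<in> borel_measurable ?V"
    if S: "S \<in> assortments N K" for S c
  proof -
    note S' = sub[OF S]
    have "(\<lambda>v. choice_prob v S c) \<in> borel_measurable ?V"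
    proof (cases "c \<in> insert 0 S")
      case True
      then show ?thesis unfolding choice_prob_def using S'
        by (simp only: if_True) (intro borel_measurable_sum borel_measurable_divide
            borel_measurable_add comp; auto)
    qed (simp add: choice_prob_def)
    moreover have "Measurable.pred ?V (\<lambda>v. 0 < v i)" "Measurable.pred ?V (\<lambda>v. 0 \<le> v i)"
      if "i \<in> {0..N}" for i
      using comp[OF that] by measurable
    then have "Measurable.pred ?V (\<lambda>v. 0 < v 0 \<and> (\<forall>i\<in>S. 0 \<le> v i))"
      using assortmentsD(1)[OF S] S'
      by (intro pred_intros_logic pred_intros_finite) auto
    ultimately have "(\<lambda>v. if 0 < v 0 \<and> (\<forall>i\<in>S. 0 \<le> v i) then choice_prob v S c
        else pmf (return_pmf 0) c) \<in> borel_measurable ?V"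
      by (intro measurable_If) (auto simp: pred_def)
    also have "(\<lambda>v. if 0 < v 0 \<and> (\<forall>i\<in>S. 0 \<le> v i) then choice_prob v S c
        else pmf (return_pmf 0) c) = (\<lambda>v. pmf (choice_pmf v S) c)"
      using pmf_choice_pmf[OF S] by (auto simp: fun_eq_iff choice_pmf_def)
    finally show ?thesis .
  qed
  have policy: "Measurable.pred (?V \<Otimes>\<^sub>M \<mu>) (\<lambda>x. p (snd x) h = S)" for h S
  proof -
    have "Measurable.pred \<mu> (\<lambda>u. p u h = S)"
      by (rule measurable_compose[OF p]) simp
    then show ?thesis by (rule measurable_compose[OF measurable_snd])
  qed
  have fst_meas: "(\<lambda>x. g (fst x)) \<in> borel_measurable (?V \<Otimes>\<^sub>M \<mu>)" if "g \<in> borel_measurable ?V"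
    for g :: "(nat \<Rightarrow> real) \<Rightarrow> real"
    using that by (rule measurable_compose[OF measurable_fst])
  have "(\<lambda>x. \<Sum>h\<in>?H. (\<Sum>t<T. revenue r (fst x) (opt_assortment N K r (fst x))
          - revenue r (fst x) (fst (h ! t))) *
        (\<Prod>i<T. if p (snd x) (take i h) = fst (h ! i)
          then pmf (choice_pmf (fst x) (fst (h ! i))) (snd (h ! i)) else 0))
      \<in> borel_measurable (?V \<Otimes>\<^sub>M \<mu>)"
  proof (intro borel_measurable_sum borel_measurable_times borel_measurable_diff
      borel_measurable_prod)
    fix h i assume "h \<in> ?H" "i \<in> {..<T}"
    then have S: "fst (h ! i) \<in> assortments N K" using nth_mem[of i h] by fastforce
    then show "(\<lambda>x. revenue r (fst x) (fst (h ! i))) \<in> borel_measurable (?V \<Otimes>\<^sub>M \<mu>)"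
      by (intro fst_meas rev)
    show "(\<lambda>x. if p (snd x) (take i h) = fst (h ! i)
        then pmf (choice_pmf (fst x) (fst (h ! i))) (snd (h ! i)) else 0)
      \<in> borel_measurable (?V \<Otimes>\<^sub>M \<mu>)"
      using policy[of "take i h" "fst (h ! i)"] fst_meas[OF choice[OF S]]
      by (intro measurable_If) (auto simp: pred_def)
  qed (intro fst_meas opt)
  also have "?this \<longleftrightarrow> ?thesis"
  proof (rule arg_cong[where f = "\<lambda>g. g \<in> _"], rule ext, clarify)
    fix v :: "nat \<Rightarrow> real" and u :: real
    interpret history_process N K p u by standard (rule offers)
    have "measure_pmf.expectation (history_pmf p u v T) g = (\<Sum>h\<in>?H. g h *
       (\<Prod>i<T. if p u (take i h) = fst (h ! i)
          then pmf (choice_pmf v (fst (h ! i))) (snd (h ! i)) else 0))" for g :: "history \<Rightarrow> real"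
    proof -
      have "measure_pmf.expectation (history_pmf p u v T) g
          = (\<Sum>h\<in>?H. g h * pmf (history_pmf p u v T) h)"
        by (rule integral_measure_pmf_real[OF finite_histories]) (rule set_mp[OF set_history_pmf])
      then show ?thesis by (simp add: pmf_history_pmf)
    qed
    then show "(\<Sum>h\<in>?H. (\<Sum>t<T. revenue r (fst (v, u)) (opt_assortment N K r (fst (v, u)))
          - revenue r (fst (v, u)) (fst (h ! t))) *
        (\<Prod>i<T. if p (snd (v, u)) (take i h) = fst (h ! i)
          then pmf (choice_pmf (fst (v, u)) (fst (h ! i))) (snd (h ! i)) else 0))
      = measure_pmf.expectation (history_pmf p u v T)
      (\<lambda>h. \<Sum>t<T. revenue r v (opt_assortment N K r v) - revenue r v (fst (h ! t)))"
      by (simp only: fst_conv snd_conv)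
  qed
  finally show ?thesis .
qed

lemma mixture_regret_bound:
  fixes r :: "nat \<Rightarrow> real" and w\<^sub>0 :: "nat \<Rightarrow> real" and w :: "nat \<Rightarrow> nat \<Rightarrow> real"
    and f :: "nat \<Rightarrow> nat set \<Rightarrow> real"
  assumes r: "\<And>i. i \<in> {1..N} \<Longrightarrow> 0 \<le> r i \<and> r i \<le> 1"
    and w\<^sub>0: "\<And>i. i \<in> {0..N} \<Longrightarrow> 0 < w\<^sub>0 i"
    and w: "\<And>j i. j < M \<Longrightarrow> i \<in> {0..N} \<Longrightarrow> 0 < w j i \<and> w j i \<le> w j 0"
    and f: "\<And>j S. j < M \<Longrightarrow> S \<in> assortments N K \<Longrightarrow> 0 \<le> f j S \<and> f j S \<le> 1"
    and f_sum: "\<And>S. S \<in> assortments N K \<Longrightarrow> (\<Sum>j<M. f j S) \<le> 1"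
    and chi: "\<And>S. S \<in> assortments N K \<Longrightarrow> (\<Sum>j<M. chi_square w\<^sub>0 (w j) S) \<le> \<kappa>"
    and gap: "\<And>j S. j < M \<Longrightarrow> S \<in> assortments N K \<Longrightarrow>
      \<exists>S'\<in>assortments N K. c * (1 - f j S) \<le> revenue r (w j) S' - revenue r (w j) S"
    and c: "0 \<le> c" and M: "2 \<le> M" and T: "0 < T" and \<kappa>: "64 * T * \<kappa> \<le> M"
  shows "\<exists>D. mnl_instance N r D \<and> (AE v in D. \<forall>i\<in>{1..N}. v i \<le> v 0) \<and>
    (\<forall>\<mu> p. admissible_policy N K \<mu> p \<longrightarrow> c * T / 4 \<le> regret N K r D \<mu> p T)"
proof -
  let ?V = "PiM {0..N} (\<lambda>_. borel) :: (nat \<Rightarrow> real) measure"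
  let ?P = "measure_pmf (pmf_of_set {..<M})"
  \<comment> \<open>Reducing modulo \<open>M\<close> keeps the integrand bounded off the support as well.\<close>
  define W where "W j = restrict (w (j mod M)) {0..N}" for j
  have modM: "j mod M < M" for j using M by simp
  have supp: "set_pmf (pmf_of_set {..<M}) = {..<M}"
    using M by (intro set_pmf_of_set) (auto simp: lessThan_empty_iff)
  have W[measurable]: "W \<in> measurable ?P ?V"
    by (auto simp: W_def space_PiM)
  have Wpos: "\<forall>i\<in>{0..N}. 0 < W j i" and Wle: "\<forall>i\<in>{1..N}. W j i \<le> W j 0" for j
    using w[OF modM] by (auto simp: W_def)
  define D where "D = distr ?P ?V W"
  have comp: "(\<lambda>v. v i) \<in> borel_measurable ?V" if "i \<in> {0..N}" for i
    using that by (rule measurable_component_singleton)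
  have AE_D: "AE v in D. Q v" if "Measurable.pred ?V Q" "\<And>j. Q (W j)" for Q
    unfolding D_def by (subst AE_distr_iff[OF W that(1)[unfolded pred_def]]) (simp add: that(2))
  have "Measurable.pred ?V (\<lambda>v. 0 < v i)" "Measurable.pred ?V (\<lambda>v. v i \<le> v 0)"
    if "i \<in> {0..N}" for i
    using comp[OF that] comp[of 0] by (auto intro!: borel_measurable_less borel_measurable_le simp: pred_def)
  then have preds: "Measurable.pred ?V (\<lambda>v. \<forall>i\<in>{0..N}. 0 < v i)"
      "Measurable.pred ?V (\<lambda>v. \<forall>i\<in>{1..N}. v i \<le> v 0)"
    by (intro pred_intros_finite; simp)+
  have prob_D: "prob_space D"
    unfolding D_def by (rule measure_pmf.prob_space_distr[OF W])
  have "sets D = sets ?V" by (simp add: D_def)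
  then have "mnl_instance N r D"
    using r AE_D[OF preds(1) Wpos] prob_D by (auto simp: mnl_instance_def)
  moreover have "AE v in D. \<forall>i\<in>{1..N}. v i \<le> v 0"
    using Wle by (intro AE_D[OF preds(2)]) simp
  moreover have "c * T / 4 \<le> regret N K r D \<mu> p T" if adm: "admissible_policy N K \<mu> p" for \<mu> p
  proof -
    have sets: "sets \<mu> = sets borel" and "prob_space \<mu>"
      using adm by (simp_all add: admissible_policy_def)
    interpret \<mu>: prob_space \<mu> by fact
    interpret pair_prob_space ?P \<mu> ..
    have offers: "p u h \<in> assortments N K" for u h
      using adm by (rule admissible_policy_offers)
    have proc: "history_process N K p u" for u by standard (rule offers)
    define gap' where "gap' j S = revenue r (W j) (opt_assortment N K r (W j)) - revenue r (W j) S"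
      for j S
    define G where "G v u = measure_pmf.expectation (history_pmf p u v T)
        (\<lambda>h. \<Sum>t<T. revenue r v (opt_assortment N K r v) - revenue r v (fst (h ! t)))" for v u
    have G_meas: "case_prod G \<in> borel_measurable (?V \<Otimes>\<^sub>M \<mu>)"
      using measurable_regret_integrand[OF adm, of T r] by (simp add: G_def case_prod_unfold)
    have GW: "G (W j) u = measure_pmf.expectation (history_pmf p u (W j) T)
        (\<lambda>h. \<Sum>t<T. gap' j (fst (h ! t)))" for j u
      by (simp add: G_def gap'_def)
    have push: "D \<Otimes>\<^sub>M \<mu> = distr (?P \<Otimes>\<^sub>M \<mu>) (?V \<Otimes>\<^sub>M \<mu>) (\<lambda>(j, u). (W j, u))"
      using pair_measure_distr[of W ?P ?V "\<lambda>u. u" \<mu> \<mu>] W \<mu>.sigma_finite_measure_axioms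
      by (simp add: D_def)
    have map_meas: "(\<lambda>(j, u). (W j, u)) \<in> measurable (?P \<Otimes>\<^sub>M \<mu>) (?V \<Otimes>\<^sub>M \<mu>)"
      by measurable
    have GW_meas: "(\<lambda>(j, u). G (W j) u) \<in> borel_measurable (?P \<Otimes>\<^sub>M \<mu>)"
      using measurable_compose[OF map_meas G_meas] by (simp add: case_prod_unfold)
    have regret_eq: "regret N K r D \<mu> p T = (\<integral>(j, u). G (W j) u \<partial>(?P \<Otimes>\<^sub>M \<mu>))"
    proof -
      have "regret N K r D \<mu> p T = integral\<^sup>L (D \<Otimes>\<^sub>M \<mu>) (case_prod G)"
        by (simp add: regret_def G_def[abs_def])
      also have "\<dots> = (\<integral>x. case_prod G (case x of (j, u) \<Rightarrow> (W j, u)) \<partial>(?P \<Otimes>\<^sub>M \<mu>))"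
        unfolding push by (rule integral_distr[OF map_meas G_meas])
      finally show ?thesis by (simp add: case_prod_unfold)
    qed
    define B where "B = (\<Sum>j<M. \<Sum>S\<in>assortments N K. \<bar>gap' j S\<bar>)"
    have gap'_le: "\<bar>gap' j S\<bar> \<le> B" if "S \<in> assortments N K" for j S
    proof -
      have "gap' j S = gap' (j mod M) S" by (simp add: gap'_def W_def)
      also have "\<bar>\<dots>\<bar> \<le> (\<Sum>S\<in>assortments N K. \<bar>gap' (j mod M) S\<bar>)"
        using that by (intro member_le_sum) (auto simp: finite_assortments)
      also have "\<dots> \<le> B"
        unfolding B_def using modM
        by (intro member_le_sum[of "j mod M" _ "\<lambda>j. \<Sum>S\<in>assortments N K. \<bar>gap' j S\<bar>"])
           (auto intro: sum_nonneg)
      finally show ?thesis .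
    qed
    have G_le: "\<bar>G (W j) u\<bar> \<le> T * B" for j u
    proof -
      interpret history_process N K p u by (rule proc)
      have "\<bar>\<Sum>t<T. gap' j (fst (h ! t))\<bar> \<le> T * B"
        if "h \<in> set_pmf (history_pmf p u (W j) T)" for h
      proof -
        have "\<bar>\<Sum>t<T. gap' j (fst (h ! t))\<bar> \<le> (\<Sum>t<T. \<bar>gap' j (fst (h ! t))\<bar>)"
          by (rule sum_abs)
        also have "\<dots> \<le> (\<Sum>t<T. B)"
          using set_mp[OF set_history_pmf that] by (intro sum_mono gap'_le) (auto dest!: nth_mem)
        finally show ?thesis by simp
      qed
      then have "measure_pmf.expectation (history_pmf p u (W j) T)
          (\<lambda>h. \<bar>\<Sum>t<T. gap' j (fst (h ! t))\<bar>)
        \<le> measure_pmf.expectation (history_pmf p u (W j) T) (\<lambda>_. T * B)"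
        by (intro integral_mono_AE integrable_history_pmf) (simp add: AE_measure_pmf_iff)
      then show ?thesis unfolding GW by (intro order_trans[OF integral_abs_bound]) simp
    qed
    have int: "integrable (?P \<Otimes>\<^sub>M \<mu>) (\<lambda>(j, u). G (W j) u)"
      by (rule P.integrable_const_bound[OF _ GW_meas, of "T * B"]) (use G_le in auto)
    have avg: "c * T / 4 \<le> (\<integral>j. G (W j) u \<partial>?P)" for u
    proof -
      interpret history_process N K p u by (rule proc)
      have W_eq: "W j i = w j i" if "j < M" "i \<in> {0..N}" for j i
        using that by (simp add: W_def)
      have sums: "(\<Sum>i\<in>S. g i (W j i)) = (\<Sum>i\<in>S. g i (w j i))"
        if "S \<in> assortments N K" "j < M" for g :: "nat \<Rightarrow> real \<Rightarrow> real" and j S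
        using assortmentsD(3)[OF that(1)] that(2) by (intro sum.cong refl) (auto simp: W_eq)
      have rev_eq: "revenue r (W j) S = revenue r (w j) S"
        if "S \<in> assortments N K" "j < M" for j S
        using sums[OF that, of "\<lambda>i x. x"] assortmentsD(3)[OF that(1)] that(2)
        unfolding revenue_def by (intro sum.cong refl) (auto simp: W_eq)
      have chi_eq: "chi_square w\<^sub>0 (W j) S = chi_square w\<^sub>0 (w j) S"
        if "S \<in> assortments N K" "j < M" for j S
        using sums[OF that, of "\<lambda>i x. x"] assortmentsD(4)[OF that(1)] that(2)
        unfolding chi_square_def
        by (intro arg_cong2[where f = minus] sum.cong refl) (auto simp: choice_prob_def W_eq)
      have "c * T * M / 4 \<le> (\<Sum>j<M. G (W j) u)"
        unfolding GW
      proof (rule expected_gap_sum_bound[where f = f and \<kappa> = \<kappa> and w\<^sub>0 = w\<^sub>0])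
        show "(\<Sum>j<M. chi_square w\<^sub>0 (W j) S) \<le> \<kappa>" if "S \<in> assortments N K" for S
          using chi[OF that] by (simp add: chi_eq[OF that])
        show "c * (1 - f j S) \<le> gap' j S" if S: "j < M" "S \<in> assortments N K" for j S
        proof -
          obtain S' where "S' \<in> assortments N K"
            "c * (1 - f j S) \<le> revenue r (w j) S' - revenue r (w j) S"
            using gap[OF S] by blast
          moreover from this(1) have "revenue r (W j) S' \<le> revenue r (W j) (opt_assortment N K r (W j))"
            by (rule revenue_le_opt)
          ultimately show ?thesis using S by (simp add: gap'_def rev_eq)
        qed
      qed (use w\<^sub>0 Wpos f f_sum c M T \<kappa> in auto)
      moreover have "(\<integral>j. G (W j) u \<partial>?P) = (\<Sum>j<M. G (W j) u) / M"
        using M by (subst integral_pmf_of_set) (auto simp: lessThan_empty_iff)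
      ultimately show ?thesis
        using M divide_right_mono[of "c * T * M / 4" "\<Sum>j<M. G (W j) u" "real M"] by simp
    qed
    have "c * T / 4 \<le> (\<integral>u. (\<integral>j. G (W j) u \<partial>?P) \<partial>\<mu>)"
      using integrable_snd[OF int] avg by (intro \<mu>.integral_ge_const) auto
    also have "\<dots> = regret N K r D \<mu> p T"
      unfolding regret_eq by (rule integral_snd[OF int])
    finally show ?thesis .
  qed
  ultimately show ?thesis by blast
qed

lemma perturbation_scale:
  fixes N K T M :: nat
  assumes "1 \<le> K" "2 \<le> M" "M \<le> T" "N \<le> 2 * M * K" and \<epsilon>: "\<epsilon> = sqrt (real M / real T) / 16"
  shows "0 < \<epsilon>" "\<epsilon> \<le> 1 / 16" "64 * real T * (2 * \<epsilon>\<^sup>2) \<le> real M"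
    "1 / 3000 * sqrt (real N * real T / real K) \<le> \<epsilon> / 30 * real T / 4"
proof -
  have T: "0 < real T" and M: "0 < real M" using assms by auto
  show "0 < \<epsilon>" using T M by (simp add: \<epsilon>)
  show "\<epsilon> \<le> 1 / 16" using T assms(3) by (simp add: \<epsilon>)
  show "64 * real T * (2 * \<epsilon>\<^sup>2) \<le> real M"
    using T M by (simp add: \<epsilon> power_divide)
  have "real N \<le> 2 * real M * real K" using assms(4) by (metis of_nat_le_iff of_nat_mult of_nat_numeral)
  then have "real N * real T / real K \<le> 2 * (real M * real T)"
    using assms(1) T by (simp add: field_simps)
  also have "\<dots> \<le> (3 / 2)\<^sup>2 * (real M * real T)" using T M by (intro mult_right_mono) (auto simp: power2_eq_square)
  finally have "sqrt (real N * real T / real K) \<le> sqrt ((3 / 2)\<^sup>2 * (real M * real T))" by simp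
  also have "\<dots> = 3 / 2 * sqrt (real M * real T)" by (simp only: real_sqrt_mult) simp
  also have "sqrt (real M * real T) = sqrt (real M / real T) * real T"
    using T by (simp add: real_sqrt_mult real_sqrt_divide field_simps)
  finally have "sqrt (real N * real T / real K) \<le> 3 / 2 * (sqrt (real M / real T) * real T)" .
  moreover have "0 \<le> sqrt (real M / real T) * real T" by simp
  ultimately show "1 / 3000 * sqrt (real N * real T / real K) \<le> \<epsilon> / 30 * real T / 4"
    unfolding \<epsilon> by linarith
qed

definition block :: "nat \<Rightarrow> nat \<Rightarrow> nat set" where
  "block K j = {j * K<..Suc j * K}"

lemma block_simps: "finite (block K j)" "card (block K j) = K" "0 \<notin> block K j"
  by (simp_all add: block_def)

lemma block_subset: "j < N div K \<Longrightarrow> block K j \<subseteq> {1..N}"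
proof -
  assume "j < N div K"
  then have "Suc j * K \<le> N div K * K" by (intro mult_le_mono1) simp
  also have "\<dots> \<le> N" by simp
  finally show ?thesis by (auto simp: block_def)
qed

lemma disjoint_blocks: "i \<noteq> j \<Longrightarrow> block K i \<inter> block K j = {}"
proof (induction i j rule: linorder_wlog)
  case (le i j)
  then have "Suc i * K \<le> j * K" by (intro mult_le_mono1) simp
  then show ?case by (auto simp: block_def)
qed (simp add: Int_commute)

lemma sum_card_Int_block_le:
  assumes "finite S"
  shows "(\<Sum>j<M. card (S \<inter> block K j)) \<le> card S"
proof -
  have "(\<Sum>j<M. card (S \<inter> block K j)) = card (\<Union>j<M. S \<inter> block K j)"
    using assms disjoint_blocks[of _ _ K] by (subst card_UN_disjoint) fastforce+
  also have "\<dots> \<le> card S" using assms by (intro card_mono) auto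
  finally show ?thesis .
qed

lemma block_instance:
  fixes N K T :: nat
  assumes K: "1 \<le> K" "2 * K \<le> N" and T: "N \<le> T"
  shows "\<exists>r D. mnl_instance N r D \<and> (AE v in D. \<forall>i\<in>{1..N}. v i \<le> v 0) \<and>
    (\<forall>\<mu> p. admissible_policy N K \<mu> p \<longrightarrow>
      1 / 3000 * sqrt (real N * real T / real K) \<le> regret N K r D \<mu> p T)"
proof -
  define M where "M = N div K"
  define \<epsilon> where "\<epsilon> = sqrt (real M / real T) / 16"
  have M: "2 \<le> M" using K div_le_mono[OF K(2), of K] by (simp add: M_def)
  have "M \<le> N" by (simp add: M_def)
  then have MT: "M \<le> T" using T by simp
  have NM: "N \<le> 2 * M * K"
  proof -
    have "N < (M + 1) * K" using K dividend_less_div_times[of K N] by (simp add: M_def algebra_simps)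
    also have "\<dots> \<le> 2 * M * K" using M by (intro mult_le_mono1) simp
    finally show ?thesis by simp
  qed
  note scale = perturbation_scale[OF K(1) M MT NM \<epsilon>_def]
  define w0 where "w0 i = (if i = 0 then 2 * real K else 1)" for i :: nat
  define w where "w j i = (if i \<in> block K j then (1 + \<epsilon>) * w0 i else w0 i)" for j i
  define f where "f j S = real (card (S \<inter> block K j)) / K" for j S
  have w0_pos: "0 < w0 i" for i using K by (simp add: w0_def)
  have sum_w0: "sum w0 S = card S" if "0 \<notin> S" for S
    using that by (simp add: w0_def cong: sum.cong_simp) (subst sum.cong[OF refl, of _ _ "\<lambda>_. 1"]; auto)
  have w_0: "w j 0 = 2 * real K" for j by (simp add: w_def w0_def block_simps)
  have sum_w: "sum (w j) S = card S + card (S \<inter> block K j) * \<epsilon>" if "finite S" "0 \<notin> S" for j S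
  proof -
    have "sum (w j) S = (\<Sum>i\<in>S. w0 i + (if i \<in> block K j then \<epsilon> else 0))"
      using that(2) by (intro sum.cong refl) (auto simp: w_def w0_def)
    also have "\<dots> = card S + (\<Sum>i\<in>S \<inter> block K j. \<epsilon>)"
      using that by (simp add: sum.distrib sum_w0 sum.inter_restrict[symmetric])
    finally show ?thesis by simp
  qed
  have rev: "revenue (\<lambda>_. 1) v S = sum v S / (v 0 + sum v S)" for v S
    by (simp add: revenue_def sum_divide_distrib)
  have "\<exists>D. mnl_instance N (\<lambda>_. 1) D \<and> (AE v in D. \<forall>i\<in>{1..N}. v i \<le> v 0) \<and>
    (\<forall>\<mu> p. admissible_policy N K \<mu> p \<longrightarrow> \<epsilon> / 30 * T / 4 \<le> regret N K (\<lambda>_. 1) D \<mu> p T)"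
  proof (rule mixture_regret_bound[where w = w and f = f and \<kappa> = "2 * \<epsilon>\<^sup>2" and w\<^sub>0 = w0 and M = M])
    show "0 < w j i \<and> w j i \<le> w j 0" for j i
      using w0_pos[of i] scale(1,2) K by (auto simp: w_def w0_def block_simps)
  next
    fix S assume S: "S \<in> assortments N K"
    note S' = assortmentsD[OF S]
    have cards: "(\<Sum>j<M. real (card (S \<inter> block K j))) \<le> K"
      using of_nat_mono[OF le_trans[OF sum_card_Int_block_le[OF S'(1)] S'(5)], where 'a = real]
      by simp
    show "0 \<le> f j S \<and> f j S \<le> 1" for j
    proof -
      have "card (S \<inter> block K j) \<le> card (block K j)" by (intro card_mono block_simps) auto
      then show ?thesis using K by (simp add: f_def block_simps)
    qed
    show "(\<Sum>j<M. f j S) \<le> 1"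
      using cards K by (simp add: f_def flip: sum_divide_distrib)
    have "chi_square w0 (w j) S \<le> \<epsilon>\<^sup>2 * (real (card (S \<inter> block K j)) / K)" for j
    proof -
      have "chi_square w0 (w j) S \<le>
          \<epsilon>\<^sup>2 / (1 + \<epsilon>) * sum w0 (S \<inter> block K j) / (w0 0 + sum w0 S)"
        by (rule chi_square_scaled_le[OF S]) (use w0_pos scale(1) in \<open>auto simp: block_simps w_def\<close>)
      also have "\<dots> = \<epsilon>\<^sup>2 / (1 + \<epsilon>) * (card (S \<inter> block K j) / (2 * real K + card S))"
        using S'(2) by (simp add: sum_w0) (simp add: w0_def)
      also have "\<dots> \<le> \<epsilon>\<^sup>2 / 1 * (card (S \<inter> block K j) / real K)"
        using scale(1) K by (intro mult_mono divide_left_mono divide_nonneg_nonneg) auto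
      finally show ?thesis by simp
    qed
    then have "(\<Sum>j<M. chi_square w0 (w j) S)
        \<le> (\<Sum>j<M. \<epsilon>\<^sup>2 * (real (card (S \<inter> block K j)) / K))" by (intro sum_mono)
    also have "\<dots> = \<epsilon>\<^sup>2 * ((\<Sum>j<M. real (card (S \<inter> block K j))) / K)"
      by (simp only: sum_distrib_left sum_divide_distrib)
    also have "\<dots> \<le> \<epsilon>\<^sup>2 * 2" using cards K by (intro mult_left_mono) (auto simp: divide_le_eq)
    finally show "(\<Sum>j<M. chi_square w0 (w j) S) \<le> 2 * \<epsilon>\<^sup>2" by simp
    show "\<exists>S'\<in>assortments N K.
        \<epsilon> / 30 * (1 - f j S) \<le> revenue (\<lambda>_. 1) (w j) S' - revenue (\<lambda>_. 1) (w j) S"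
      if j: "j < M" for j
    proof (rule bexI)
      show "block K j \<in> assortments N K"
        using block_subset j by (auto simp: assortments_def block_simps M_def)
      define k X x where "k = real (card (S \<inter> block K j))" and "X = K * (1 + \<epsilon>)"
        and "x = card S + k * \<epsilon>"
      have K0: "0 < real K" using K by simp
      have kK: "k \<le> K" using card_mono[of "block K j" "S \<inter> block K j"] by (simp add: k_def block_simps)
      have k: "0 \<le> k" by (simp add: k_def)
      have x0: "0 \<le> x" using k scale(1) by (simp add: x_def)
      have Xx: "(K - k) * \<epsilon> \<le> X - x" using S'(5) by (simp add: X_def x_def algebra_simps)
      moreover have "0 \<le> (K - k) * \<epsilon>" using kK scale(1) by simp
      ultimately have "x \<le> X" by linarith
      have "real K * \<epsilon> \<le> real K * 1" using scale(2) by (intro mult_left_mono) auto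
      then have XK: "X \<le> 2 * K" by (simp add: X_def algebra_simps)
      have den: "(2 * real K + X) * (2 * real K + x) \<le> (4 * real K) * (4 * real K)"
        using XK \<open>x \<le> X\<close> x0 K0 by (intro mult_mono) auto
      have "\<epsilon> / 30 * (1 - f j S) \<le> \<epsilon> / 8 * (1 - k / K)"
        using kK K0 scale(1) by (intro mult_mono) (auto simp: f_def k_def)
      also have "\<dots> = 2 * K * ((K - k) * \<epsilon>) / ((4 * real K) * (4 * real K))"
        using K0 by (simp add: field_simps)
      also have "\<dots> \<le> 2 * K * (X - x) / ((2 * real K + X) * (2 * real K + x))"
        using Xx \<open>x \<le> X\<close> x0 K0
        by (intro frac_le den mult_left_mono mult_pos_pos) auto
      also have "\<dots> = X / (2 * real K + X) - x / (2 * real K + x)"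
        using x0 \<open>x \<le> X\<close> K0 by (simp add: field_simps)
      also have "\<dots> = revenue (\<lambda>_. 1) (w j) (block K j) - revenue (\<lambda>_. 1) (w j) S"
        using S' by (simp add: rev sum_w w_0 block_simps X_def x_def k_def algebra_simps)
      finally show "\<epsilon> / 30 * (1 - f j S)
          \<le> revenue (\<lambda>_. 1) (w j) (block K j) - revenue (\<lambda>_. 1) (w j) S" .
    qed
  qed (use w0_pos scale M MT in auto)
  then show ?thesis using scale(4) by (meson order_trans)
qed

lemma two_point_instance:
  fixes N K T :: nat
  assumes K: "2 \<le> K" "N < 2 * K" and N: "2 \<le> N" and T: "N \<le> T"
  shows "\<exists>r D. mnl_instance N r D \<and> (AE v in D. \<forall>i\<in>{1..N}. v i \<le> v 0) \<and>
    (\<forall>\<mu> p. admissible_policy N K \<mu> p \<longrightarrow>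
      1 / 3000 * sqrt (real N * real T / real K) \<le> regret N K r D \<mu> p T)"
proof -
  define \<epsilon> where "\<epsilon> = sqrt (real (2::nat) / real T) / 16"
  have "1 \<le> K" "2 \<le> T" "N \<le> 2 * 2 * K" using K N T by auto
  note scale = perturbation_scale[OF this(1) order_refl this(2,3) \<epsilon>_def]
  define w0 where "w0 i = (if i = 0 then 2 else 1 :: real)" for i :: nat
  define \<delta> where "\<delta> j = (if j = 0 then \<epsilon> else - \<epsilon>)" for j :: nat
  define w where "w j i = (if i \<in> {1} then (1 + \<delta> j) * w0 i else w0 i)" for j i
  define f where "f j S = (if (2 \<in> S) = (j = 0) then 0 else 1 :: real)" for j :: nat and S :: "nat set"
  define r where "r i = (if i = 1 then 1 else if i = 2 then 1 / 3 else 0 :: real)" for i :: nat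
  have \<delta>: "\<bar>\<delta> j\<bar> \<le> 1 / 16" "(\<delta> j)\<^sup>2 = \<epsilon>\<^sup>2" for j using scale(1,2) by (auto simp: \<delta>_def)
  have w0_pos: "0 < w0 i" for i by (simp add: w0_def)
  define R where "R j a b m = (a * (1 + \<delta> j) + b / 3) / (2 + a * (1 + \<delta> j) + b + m)"
    for j and a b m :: real
  have rev: "revenue r (w j) S = R j (of_bool (1 \<in> S)) (of_bool (2 \<in> S)) (card (S - {1, 2}))"
    if "finite S" "0 \<notin> S" for j S
  proof -
    have split: "sum g S = of_bool (1 \<in> S) * g 1 + of_bool (2 \<in> S) * g 2 + sum g (S - {1, 2})"
      for g :: "nat \<Rightarrow> real"
      unfolding sum.Int_Diff[OF that(1), of g "{1, 2}"]
      by (cases "1 \<in> S"; cases "2 \<in> S") simp_all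
    have "sum (w j) (S - {1, 2}) = (\<Sum>i\<in>S - {1, 2}. 1)"
      using that by (intro sum.cong refl) (auto simp: w_def w0_def intro!: gr0I)
    moreover have "(\<Sum>i\<in>S - {1, 2}. r i * w j i) = 0" by (intro sum.neutral) (auto simp: r_def)
    ultimately show ?thesis
      unfolding revenue_def sum_divide_distrib[symmetric] R_def
      by (subst (1 2) split) (simp add: w_def w0_def r_def algebra_simps)
  qed
  have R_le: "R j a b m \<le> R j a b 0" if "0 \<le> a" "0 \<le> b" "0 \<le> m" for j a b m
  proof -
    have "0 \<le> a * (1 + \<delta> j)" using that \<delta>(1)[of j] by (intro mult_nonneg_nonneg) auto
    then show ?thesis
      unfolding R_def using that by (intro divide_left_mono mult_pos_pos) auto
  qed
  have e: "0 < \<epsilon>" "\<epsilon> \<le> 1 / 16" by (fact scale)+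
  have gain0: "\<epsilon> / 30 \<le> R 0 1 0 0 - R 0 a 1 0" if "a = 0 \<or> a = 1" for a
  proof (cases "a = 0")
    case True
    have "1 / 3 \<le> (1 + \<epsilon>) / (3 + \<epsilon>)" using e by (simp add: field_simps)
    moreover have "R 0 1 0 0 = (1 + \<epsilon>) / (3 + \<epsilon>)" "R 0 0 1 0 = 1 / 9"
      by (simp_all add: R_def \<delta>_def)
    ultimately show ?thesis unfolding True using e by linarith
  next
    case False
    have "\<epsilon> / 30 = (2 / 3 * \<epsilon>) / (4 * 5)" by simp
    also have "\<dots> \<le> (2 / 3 * \<epsilon>) / ((3 + \<epsilon>) * (4 + \<epsilon>))"
      using e by (intro divide_left_mono mult_mono mult_pos_pos) auto
    also have "\<dots> = (1 + \<epsilon>) / (3 + \<epsilon>) - (4 / 3 + \<epsilon>) / (4 + \<epsilon>)"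
      using e by (simp add: field_simps)
    finally show ?thesis using False that by (simp add: R_def \<delta>_def algebra_simps)
  qed
  have gain1: "\<epsilon> / 30 \<le> R 1 1 1 0 - R 1 a 0 0" if "a = 0 \<or> a = 1" for a
  proof (cases "a = 0")
    case True
    have "1 / 4 \<le> (4 / 3 - \<epsilon>) / (4 - \<epsilon>)" using e by (simp add: field_simps)
    moreover have "R 1 1 1 0 = (4 / 3 - \<epsilon>) / (4 - \<epsilon>)" "R 1 0 0 0 = 0"
      by (simp_all add: R_def \<delta>_def)
    ultimately show ?thesis unfolding True using e by linarith
  next
    case False
    have "\<epsilon> / 30 \<le> (2 / 3 * \<epsilon>) / (3 * 4)" using e by simp
    also have "\<dots> \<le> (2 / 3 * \<epsilon>) / ((3 - \<epsilon>) * (4 - \<epsilon>))"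
      using e by (intro divide_left_mono mult_mono mult_pos_pos) auto
    also have "\<dots> = (4 / 3 - \<epsilon>) / (4 - \<epsilon>) - (1 - \<epsilon>) / (3 - \<epsilon>)"
      using e by (simp add: field_simps)
    finally show ?thesis using False that by (simp add: R_def \<delta>_def algebra_simps)
  qed
  have mono0: "R 0 0 0 0 \<le> R 0 1 0 0" using e by (simp add: R_def \<delta>_def)
  have mono1: "R 1 0 1 0 \<le> R 1 1 1 0" using e by (simp add: R_def \<delta>_def field_simps)
  have "\<exists>D. mnl_instance N r D \<and> (AE v in D. \<forall>i\<in>{1..N}. v i \<le> v 0) \<and>
    (\<forall>\<mu> p. admissible_policy N K \<mu> p \<longrightarrow> \<epsilon> / 30 * T / 4 \<le> regret N K r D \<mu> p T)"
  proof (rule mixture_regret_bound[where w = w and f = f and \<kappa> = "2 * \<epsilon>\<^sup>2" and w\<^sub>0 = w0 and M = 2])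
    show "0 < w j i \<and> w j i \<le> w j 0" for j i
      using \<delta>(1)[of j] by (auto simp: w_def w0_def)
  next
    fix S assume S: "S \<in> assortments N K"
    note S' = assortmentsD[OF S]
    show "0 \<le> f j S \<and> f j S \<le> 1" for j by (simp add: f_def)
    show "(\<Sum>j<2. f j S) \<le> 1" by (simp add: f_def numeral_2_eq_2)
    have "chi_square w0 (w j) S \<le> \<epsilon>\<^sup>2" for j
    proof -
      have "chi_square w0 (w j) S \<le>
          (\<delta> j)\<^sup>2 / (1 + \<delta> j) * sum w0 (S \<inter> {1}) / (w0 0 + sum w0 S)"
        by (rule chi_square_scaled_le[OF S]) (use w0_pos \<delta>(1)[of j] in \<open>auto simp: w_def\<close>)
      also have "\<dots> \<le> \<epsilon>\<^sup>2 / (1/2) * 1 / 2"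
        unfolding \<delta>(2)
      proof (intro frac_le mult_mono)
        show "sum w0 (S \<inter> {1}) \<le> 1" by (cases "1 \<in> S") (simp_all add: w0_def)
        show "2 \<le> w0 0 + sum w0 S" using w0_pos by (simp add: w0_def[of 0] sum_nonneg less_imp_le)
      qed (use \<delta>(1)[of j] w0_pos in \<open>auto intro: sum_nonneg less_imp_le\<close>)
      finally show ?thesis by simp
    qed
    from add_mono[OF this[of 0] this[of 1]]
    show "(\<Sum>j<2. chi_square w0 (w j) S) \<le> 2 * \<epsilon>\<^sup>2" by (simp add: numeral_2_eq_2)
    let ?a = "of_bool (1 \<in> S) :: real" and ?b = "of_bool (2 \<in> S) :: real"
    have rS: "revenue r (w j) S \<le> R j ?a ?b 0" for j
      unfolding rev[OF S'(1,2)] by (rule R_le) auto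
    show "\<exists>S'\<in>assortments N K. \<epsilon> / 30 * (1 - f j S) \<le> revenue r (w j) S' - revenue r (w j) S"
      if j: "j < 2" for j
    proof (cases "j = 0")
      case True
      have "\<epsilon> / 30 * (1 - f j S) \<le> R j 1 0 0 - R j ?a ?b 0"
        using gain0[of 0] gain0[of 1] mono0 True by (auto simp: f_def)
      also have "\<dots> \<le> revenue r (w j) {1} - revenue r (w j) S"
        using rS[of j] by (simp add: rev)
      finally show ?thesis using K N by (intro bexI[of _ "{1}"]) (auto simp: assortments_def)
    next
      case False
      then have "j = 1" using j by simp
      then have "\<epsilon> / 30 * (1 - f j S) \<le> R j 1 1 0 - R j ?a ?b 0"
        using gain1[of 0] gain1[of 1] mono1 by (auto simp: f_def)
      also have "\<dots> \<le> revenue r (w j) {1, 2} - revenue r (w j) S"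
        using rS[of j] by (simp add: rev)
      finally show ?thesis using K N by (intro bexI[of _ "{1, 2}"]) (auto simp: assortments_def)
    qed
  qed (use w0_pos scale T N in \<open>auto simp: r_def\<close>)
  then show ?thesis using scale(4) by (meson order_trans)
qed

theorem theorem2:
  "\<exists>C::real. 0 < C \<and>
     (\<forall>(N::nat) (K::nat) (T::nat). 2 \<le> N \<and> 1 \<le> K \<and> N \<le> T \<longrightarrow>
       (\<exists>(r :: nat \<Rightarrow> real) (D :: (nat \<Rightarrow> real) measure).
          mnl_instance N r D \<and>
          (AE v in D. \<forall>i\<in>{1..N}. v i \<le> v 0) \<and>
          (\<forall>(\<mu> :: real measure) (p :: policy). admissible_policy N K \<mu> p \<longrightarrow>
             regret N K r D \<mu> p T \<ge> C * sqrt (real N * real T / real K))))"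
proof (intro exI[of _ "1 / 3000"] conjI allI impI)
  fix N K T :: nat assume "2 \<le> N \<and> 1 \<le> K \<and> N \<le> T"
  then show "\<exists>r D. mnl_instance N r D \<and> (AE v in D. \<forall>i\<in>{1..N}. v i \<le> v 0) \<and>
    (\<forall>\<mu> p. admissible_policy N K \<mu> p \<longrightarrow>
      1 / 3000 * sqrt (real N * real T / real K) \<le> regret N K r D \<mu> p T)"
    by (cases "2 * K \<le> N") (intro block_instance two_point_instance; simp)+
qed simp

end
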